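(* Let $f:A\to B$ and $g:A\to C$ be ring homomorphisms, and let $J$ be an ideal of $B$ and $J'$ an ideal of $C$ such that $I_o:=f^{-1}(J)=g^{-1}(J')$. Put $Y:=\operatorname{Spec}(f(A)+J)$ and $Y':=\operatorname{Spec}(g(A)+J')$. Let $P$ be a prime ideal of $A\bowtie^{f,g}(J,J')$. Then: \begin{enumerate} \item $J\times J'\subseteq P$ if and only if there exists a unique $p\in\operatorname{Spec}(A)$ with $p\supseteq I_o$ such that $P=p\bowtie^{f,g}(J,J')$. In this case, there exist $L\in Y$ with $L\supseteq J$ and $L'\in Y'$ with $L'\supseteq J'$ such that $P=\bar L=\bar{L'}$. \item $J\times J'\nsubseteq P$ if and only if either there exists a unique $L\in Y$ such that $J\nsubseteq L$ and $P=\bar L$, or there exists a unique $L\in Y'$ such that $J'\nsubseteq L$ and $P=\bar L$. In the first case $(A\bowtie^{f,g}(J,J'))_P\cong(f(A)+J)_L$, and in the second case $(A\bowtie^{f,g}(J,J'))_P\cong(g(A)+J')_L$. \end{enumerate} Consequently, $$\operatorname{Spec}\big(A\bowtie^{f,g}(J,J')\big)=\big\{\bar L\mid L\in\operatorname{Spec}(f(A)+J)\cup\operatorname{Spec}(g(A)+J')\big\}.$$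
   Context: All rings are commutative with unity, and ring homomorphisms are unital. The bi-amalgamation of $A$ with $(B,C)$ along $(J,J')$ with respect to $(f,g)$ is the subring of $B\times C$ $$A\bowtie^{f,g}(J,J'):=\{(f(a)+j,\,g(a)+j')\mid a\in A,\ (j,j')\in J\times J'\}.$$ Here $f(A)+J=\{f(a)+j\mid a\in A, j\in J\}$ is a subring of $B$ and $g(A)+J'$ is a subring of $C$ (defined analogously). For an ideal $I$ of $A$, $$I\bowtie^{f,g}(J,J'):=\{(f(i)+j,\,g(i)+j')\mid i\in I,\ (j,j')\in J\times J'\},$$ which is an ideal of $A\bowtie^{f,g}(J,J')$ containing $J\times J'$. For $L\in Y=\operatorname{Spec}(f(A)+J)$, $\bar L:=\big(L\times(g(A)+J')\big)\cap\big(A\bowtie^{f,g}(J,J')\big)$, i.e. the set of $(f(a)+j,g(a)+j')$ with $a\in A$, $(j,j')\in J\times J'$ and $f(a)+j\in L$. For $L'\in Y'=\operatorname{Spec}(g(A)+J')$, $\bar{L'}:=\big((f(A)+J)\times L'\big)\cap\big(A\bowtie^{f,g}(J,J')\big)$, i.e. the set of such elements with $g(a)+j'\in L'$. These are prime ideals of $A\bowtie^{f,g}(J,J')$. The union in the last formula is to be understood as a disjoint one: the bar has the first meaning for $L\in Y$ and the second for $L\in Y'$. $R_P$ denotes the localization of a ring $R$ at a prime ideal $P$. *)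

theory Defs
  imports "HOL-Algebra.Chinese_Remainder"
begin

definition Spec :: "('a, 'm) ring_scheme \<Rightarrow> 'a set set"
  where "Spec R = {P. primeideal P R}"


subsection \<open>Localization of a commutative ring\<close>

text \<open>
  The set \<open>S\<close> is meant to be a multiplicative subset of \<open>R\<close>. The fraction \<open>r/s\<close> is the class of
  the pair \<open>(r, s)\<close>. The witness \<open>u\<close> is needed because \<open>R\<close> may have zero divisors.
\<close>

definition fraction_rel :: "('a, 'm) ring_scheme \<Rightarrow> 'a set \<Rightarrow> (('a \<times> 'a) \<times> ('a \<times> 'a)) set"
  where "fraction_rel R S =
    {((r, s), (r', s')) | r s r' s'.
       r \<in> carrier R \<and> s \<in> S \<and> r' \<in> carrier R \<and> s' \<in> S \<and>
       (\<exists>u\<in>S. u \<otimes>\<^bsub>R\<^esub> ((r \<otimes>\<^bsub>R\<^esub> s') \<ominus>\<^bsub>R\<^esub> (r' \<otimes>\<^bsub>R\<^esub> s)) = \<zero>\<^bsub>R\<^esub>)}"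

definition fraction :: "('a, 'm) ring_scheme \<Rightarrow> 'a set \<Rightarrow> 'a \<Rightarrow> 'a \<Rightarrow> ('a \<times> 'a) set"
  where "fraction R S r s = fraction_rel R S `` {(r, s)}"

text \<open>
  The operations take the union over all representatives; as they respect \<^const>\<open>fraction_rel\<close>
  when \<open>S\<close> is multiplicative, the sets in such a union are all the same class.
\<close>

definition localization :: "('a, 'm) ring_scheme \<Rightarrow> 'a set \<Rightarrow> ('a \<times> 'a) set ring"
  where "localization R S =
    \<lparr> carrier = (carrier R \<times> S) // fraction_rel R S,
      mult = (\<lambda>u v. \<Union>(r, s)\<in>u. \<Union>(r', s')\<in>v. fraction R S (r \<otimes>\<^bsub>R\<^esub> r') (s \<otimes>\<^bsub>R\<^esub> s')),
      one = fraction R S \<one>\<^bsub>R\<^esub> \<one>\<^bsub>R\<^esub>,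
      zero = fraction R S \<zero>\<^bsub>R\<^esub> \<one>\<^bsub>R\<^esub>,
      add = (\<lambda>u v. \<Union>(r, s)\<in>u. \<Union>(r', s')\<in>v.
               fraction R S ((r \<otimes>\<^bsub>R\<^esub> s') \<oplus>\<^bsub>R\<^esub> (r' \<otimes>\<^bsub>R\<^esub> s)) (s \<otimes>\<^bsub>R\<^esub> s')) \<rparr>"

definition localization_at :: "('a, 'm) ring_scheme \<Rightarrow> 'a set \<Rightarrow> ('a \<times> 'a) set ring"
  where "localization_at R P = localization R (carrier R - P)"


subsection \<open>Bi-amalgamations\<close>

text \<open>The subring \<open>f(A) + J\<close> of \<open>B\<close>.\<close>

definition image_plus ::
    "('a, 'm) ring_scheme \<Rightarrow> ('b, 'n) ring_scheme \<Rightarrow> ('a \<Rightarrow> 'b) \<Rightarrow> 'b set \<Rightarrow> ('b, 'n) ring_scheme"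
  where "image_plus A B f J = B\<lparr>carrier := {f a \<oplus>\<^bsub>B\<^esub> j | a j. a \<in> carrier A \<and> j \<in> J}\<rparr>"

text \<open>
  The set \<open>I \<bowtie> (J, J')\<close>, for an ideal \<open>I\<close> of \<open>A\<close> as well as for \<open>I = A\<close>.
\<close>

definition bi_amalg_set ::
    "('b, 'n) ring_scheme \<Rightarrow> ('c, 'k) ring_scheme \<Rightarrow> ('a \<Rightarrow> 'b) \<Rightarrow> ('a \<Rightarrow> 'c) \<Rightarrow>
     'a set \<Rightarrow> 'b set \<Rightarrow> 'c set \<Rightarrow> ('b \<times> 'c) set"
  where "bi_amalg_set B C f g I J J' =
    {(f i \<oplus>\<^bsub>B\<^esub> j, g i \<oplus>\<^bsub>C\<^esub> j') | i j j'. i \<in> I \<and> j \<in> J \<and> j' \<in> J'}"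

definition bi_amalg ::
    "('a, 'm) ring_scheme \<Rightarrow> ('b, 'n) ring_scheme \<Rightarrow> ('c, 'k) ring_scheme \<Rightarrow>
     ('a \<Rightarrow> 'b) \<Rightarrow> ('a \<Rightarrow> 'c) \<Rightarrow> 'b set \<Rightarrow> 'c set \<Rightarrow> ('b \<times> 'c) ring"
  where "bi_amalg A B C f g J J' =
    (RDirProd B C)\<lparr>carrier := bi_amalg_set B C f g (carrier A) J J'\<rparr>"

text \<open>
  The two meanings of the bar, for \<open>L\<close> in the spectrum of \<open>f(A) + J\<close> and of \<open>g(A) + J'\<close>.
\<close>

definition bar_fst ::
    "('a, 'm) ring_scheme \<Rightarrow> ('b, 'n) ring_scheme \<Rightarrow> ('c, 'k) ring_scheme \<Rightarrow>
     ('a \<Rightarrow> 'b) \<Rightarrow> ('a \<Rightarrow> 'c) \<Rightarrow> 'b set \<Rightarrow> 'c set \<Rightarrow> 'b set \<Rightarrow> ('b \<times> 'c) set"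
  where "bar_fst A B C f g J J' L =
    (L \<times> carrier (image_plus A C g J')) \<inter> carrier (bi_amalg A B C f g J J')"

definition bar_snd ::
    "('a, 'm) ring_scheme \<Rightarrow> ('b, 'n) ring_scheme \<Rightarrow> ('c, 'k) ring_scheme \<Rightarrow>
     ('a \<Rightarrow> 'b) \<Rightarrow> ('a \<Rightarrow> 'c) \<Rightarrow> 'b set \<Rightarrow> 'c set \<Rightarrow> 'c set \<Rightarrow> ('b \<times> 'c) set"
  where "bar_snd A B C f g J J' L =
    (carrier (image_plus A B f J) \<times> L) \<inter> carrier (bi_amalg A B C f g J J')"

end

theory Submission
  imports Defs "HOL-Algebra.Multiplicative_Group" "HOL-Algebra.Subrings"
begin

text \<open>
  The two projections map \<open>R = A \<bowtie> (J, J')\<close> onto \<open>f(A) + J\<close> and \<open>g(A) + J'\<close>. Because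
  \<open>J\<close> and \<open>J'\<close> have the same preimage in \<open>A\<close>, their kernels are \<open>0 \<times> J'\<close> and \<open>J \<times> 0\<close>.
  The bars are the pullbacks of prime ideals along the projections, so they are exactly the primes
  containing one of the kernels. The product of the kernels is zero, hence every prime contains one
  of them, and it contains both iff it contains their sum \<open>J \<times> J'\<close>. If it contains only one,
  an element \<open>u\<close> of the other kernel that lies outside the prime annihilates the first one, so that
  the projection becomes an isomorphism after localization.
\<close>

subsection \<open>Localization along a surjection\<close>

locale mult_subset = cring R + submonoid M R for M and R (structure)
begin

lemma fraction_rel_iff:
  \<comment> \<open>Distributing \<open>u\<close> over the difference leaves an equation between
    products, which can be handled by commutative rewriting alone.\<close>
  "((r, s), (r', s')) \<in> fraction_rel R M \<longleftrightarrow>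
     r \<in> carrier R \<and> s \<in> M \<and> r' \<in> carrier R \<and> s' \<in> M \<and>
     (\<exists>u\<in>M. u \<otimes> (r \<otimes> s') = u \<otimes> (r' \<otimes> s))"
proof -
  have "u \<otimes> (r \<otimes> s' \<ominus> r' \<otimes> s) = \<zero> \<longleftrightarrow> u \<otimes> (r \<otimes> s') = u \<otimes> (r' \<otimes> s)"
    if "r \<in> carrier R" "s \<in> M" "r' \<in> carrier R" "s' \<in> M" "u \<in> M" for u
  proof -
    have "u \<otimes> (r \<otimes> s' \<ominus> r' \<otimes> s) = u \<otimes> (r \<otimes> s') \<ominus> u \<otimes> (r' \<otimes> s)"
      using that mem_carrier by (simp add: a_minus_def r_distr r_minus)
    then show ?thesis
      using that mem_carrier by (simp add: r_right_minus_eq)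
  qed
  then show ?thesis
    unfolding fraction_rel_def by blast
qed

lemma equiv_fraction_rel: "equiv (carrier R \<times> M) (fraction_rel R M)"
proof (rule equivI)
  show "fraction_rel R M \<subseteq> (carrier R \<times> M) \<times> carrier R \<times> M"
    by (auto simp: fraction_rel_def)
  show "refl_on (carrier R \<times> M) (fraction_rel R M)"
    using one_closed by (intro refl_onI) (auto simp: fraction_rel_iff)
  show "sym (fraction_rel R M)"
    by (rule symI) (auto simp: fraction_rel_iff intro!: bexI dest: sym)
  show "trans (fraction_rel R M)"
  proof (rule transI, clarify)
    fix r s r' s' r'' s''
    assume "((r, s), (r', s')) \<in> fraction_rel R M" "((r', s'), (r'', s'')) \<in> fraction_rel R M"
    then obtain u v where M: "s \<in> M" "s' \<in> M" "s'' \<in> M" "u \<in> M" "v \<in> M"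
      and R: "r \<in> carrier R" "r' \<in> carrier R" "r'' \<in> carrier R"
      and u: "u \<otimes> (r \<otimes> s') = u \<otimes> (r' \<otimes> s)" and v: "v \<otimes> (r' \<otimes> s'') = v \<otimes> (r'' \<otimes> s')"
      by (auto simp: fraction_rel_iff)
    note [simp] = M[THEN mem_carrier] R
    \<comment> \<open>The witness for transitivity is the product of both given witnesses and the
      middle denominator \<open>s'\<close>, which occurs in one side of each hypothesis.\<close>
    have "(u \<otimes> v \<otimes> s') \<otimes> (r \<otimes> s'') = (u \<otimes> (r \<otimes> s')) \<otimes> (v \<otimes> s'')"
      by (simp add: m_ac)
    also have "\<dots> = (v \<otimes> (r' \<otimes> s'')) \<otimes> (u \<otimes> s)"
      unfolding u by (simp add: m_ac)
    also have "\<dots> = (u \<otimes> v \<otimes> s') \<otimes> (r'' \<otimes> s)"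
      unfolding v by (simp add: m_ac)
    finally show "((r, s), (r'', s'')) \<in> fraction_rel R M"
      unfolding fraction_rel_iff using M R by blast
  qed
qed

lemma fraction_eq_iff:
  assumes "r \<in> carrier R" "s \<in> M" "r' \<in> carrier R" "s' \<in> M"
  shows "fraction R M r s = fraction R M r' s' \<longleftrightarrow> (\<exists>u\<in>M. u \<otimes> (r \<otimes> s') = u \<otimes> (r' \<otimes> s))"
  unfolding fraction_def
  using eq_equiv_class_iff[OF equiv_fraction_rel, of "(r, s)" "(r', s')"] assms fraction_rel_iff
  by auto

lemma fraction_self: "r \<in> carrier R \<Longrightarrow> s \<in> M \<Longrightarrow> (r, s) \<in> fraction R M r s"
  unfolding fraction_def by (rule equiv_class_self[OF equiv_fraction_rel]) simp

lemma fraction_mem: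
  assumes "(r', s') \<in> fraction R M r s"
  shows "r \<in> carrier R" "s \<in> M" "r' \<in> carrier R" "s' \<in> M" "fraction R M r' s' = fraction R M r s"
proof -
  have rel: "((r, s), (r', s')) \<in> fraction_rel R M"
    using assms by (simp add: fraction_def)
  then show "r \<in> carrier R" "s \<in> M" "r' \<in> carrier R" "s' \<in> M"
    by (simp_all add: fraction_rel_iff)
  show "fraction R M r' s' = fraction R M r s"
    unfolding fraction_def using equiv_class_eq[OF equiv_fraction_rel rel] by simp
qed

lemma carrier_localization:
  "carrier (localization R M) = {fraction R M r s | r s. r \<in> carrier R \<and> s \<in> M}"
  by (auto simp: localization_def quotient_def fraction_def)

text \<open>Collapses the unions in the ring operations: if \<open>F\<close> does not depend on the
  representative, all sets in the union coincide, and there is at least one because a class contains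
  its own representative.\<close>

lemma UN_fraction:
  assumes "r \<in> carrier R" "s \<in> M"
    and "\<And>r' s'. r' \<in> carrier R \<Longrightarrow> s' \<in> M \<Longrightarrow> fraction R M r' s' = fraction R M r s
            \<Longrightarrow> F r' s' = F r s"
  shows "(\<Union>(r', s')\<in>fraction R M r s. F r' s') = F r s"
proof -
  have "(\<Union>(r', s')\<in>fraction R M r s. F r' s') = (\<Union>x\<in>fraction R M r s. F r s)"
    by (intro SUP_cong refl) (clarify, rule assms(3); erule fraction_mem)
  also have "\<dots> = F r s"
    using fraction_self[OF assms(1,2)] by (subst UN_constant) auto
  finally show ?thesis .
qed

text \<open>\<open>cong\<close> is independence of representatives; the witnesses of the two
  equalities multiply to a witness for the products. It lets \<open>UN_fraction\<close> collapse the
  double union, the inner one first.\<close>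

lemma mult_fraction:
  assumes R: "r \<in> carrier R" "r' \<in> carrier R" and M: "s \<in> M" "s' \<in> M"
  shows "fraction R M r s \<otimes>\<^bsub>localization R M\<^esub> fraction R M r' s' = fraction R M (r \<otimes> r') (s \<otimes> s')"
proof -
  have cong: "fraction R M (a \<otimes> a') (t \<otimes> t') = fraction R M (b \<otimes> b') (w \<otimes> w')"
    if eq: "fraction R M a t = fraction R M b w" "fraction R M a' t' = fraction R M b' w'"
      and R: "a \<in> carrier R" "b \<in> carrier R" "a' \<in> carrier R" "b' \<in> carrier R"
      and M: "t \<in> M" "w \<in> M" "t' \<in> M" "w' \<in> M" for a a' b b' t t' w w'
  proof -
    obtain u v where uv: "u \<in> M" "v \<in> M"
      and u: "u \<otimes> (a \<otimes> w) = u \<otimes> (b \<otimes> t)" and v: "v \<otimes> (a' \<otimes> w') = v \<otimes> (b' \<otimes> t')"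
      using eq R M by (auto simp: fraction_eq_iff)
    note [simp] = M[THEN mem_carrier] R uv[THEN mem_carrier]
    have "(u \<otimes> v) \<otimes> (a \<otimes> a' \<otimes> (w \<otimes> w')) = (u \<otimes> (a \<otimes> w)) \<otimes> (v \<otimes> (a' \<otimes> w'))"
      by (simp add: m_ac)
    also have "\<dots> = (u \<otimes> v) \<otimes> (b \<otimes> b' \<otimes> (t \<otimes> t'))"
      unfolding u v by (simp add: m_ac)
    finally show ?thesis
      using R M uv by (subst fraction_eq_iff) auto
  qed
  have "(\<Union>(a', t')\<in>fraction R M r' s'. fraction R M (a \<otimes> a') (t \<otimes> t')) = fraction R M (a \<otimes> r') (t \<otimes> s')"
    if "a \<in> carrier R" "t \<in> M" for a t
    by (rule UN_fraction; (rule cong)?) (use that R M in auto)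
  then have "(\<Union>(a, t)\<in>fraction R M r s. \<Union>(a', t')\<in>fraction R M r' s'. fraction R M (a \<otimes> a') (t \<otimes> t'))
      = (\<Union>(a, t)\<in>fraction R M r s. fraction R M (a \<otimes> r') (t \<otimes> s'))"
    by (intro SUP_cong refl) (auto dest: fraction_mem)
  also have "\<dots> = fraction R M (r \<otimes> r') (s \<otimes> s')"
    by (rule UN_fraction; (rule cong)?) (use R M in auto)
  finally show ?thesis
    by (simp add: localization_def)
qed

lemma add_fraction:
  assumes R: "r \<in> carrier R" "r' \<in> carrier R" and M: "s \<in> M" "s' \<in> M"
  shows "fraction R M r s \<oplus>\<^bsub>localization R M\<^esub> fraction R M r' s'
    = fraction R M (r \<otimes> s' \<oplus> r' \<otimes> s) (s \<otimes> s')"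
proof -
  have cong: "fraction R M (a \<otimes> t' \<oplus> a' \<otimes> t) (t \<otimes> t') = fraction R M (b \<otimes> w' \<oplus> b' \<otimes> w) (w \<otimes> w')"
    if eq: "fraction R M a t = fraction R M b w" "fraction R M a' t' = fraction R M b' w'"
      and R: "a \<in> carrier R" "b \<in> carrier R" "a' \<in> carrier R" "b' \<in> carrier R"
      and M: "t \<in> M" "w \<in> M" "t' \<in> M" "w' \<in> M" for a a' b b' t t' w w'
  proof -
    obtain u v where uv: "u \<in> M" "v \<in> M"
      and u: "u \<otimes> (a \<otimes> w) = u \<otimes> (b \<otimes> t)" and v: "v \<otimes> (a' \<otimes> w') = v \<otimes> (b' \<otimes> t')"
      using eq R M by (auto simp: fraction_eq_iff)
    note [simp] = M[THEN mem_carrier] R uv[THEN mem_carrier]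
    \<comment> \<open>Each summand is regrouped so that the left side of \<open>u\<close> or of
      \<open>v\<close> appears as a factor.\<close>
    have "(u \<otimes> v) \<otimes> ((a \<otimes> t' \<oplus> a' \<otimes> t) \<otimes> (w \<otimes> w'))
        = (u \<otimes> (a \<otimes> w)) \<otimes> (v \<otimes> (t' \<otimes> w')) \<oplus> (v \<otimes> (a' \<otimes> w')) \<otimes> (u \<otimes> (t \<otimes> w))"
      by (simp add: m_ac l_distr r_distr)
    also have "\<dots> = (u \<otimes> v) \<otimes> ((b \<otimes> w' \<oplus> b' \<otimes> w) \<otimes> (t \<otimes> t'))"
      unfolding u v by (simp add: m_ac l_distr r_distr)
    finally show ?thesis
      using R M uv by (subst fraction_eq_iff) auto
  qed
  have "(\<Union>(a', t')\<in>fraction R M r' s'. fraction R M (a \<otimes> t' \<oplus> a' \<otimes> t) (t \<otimes> t'))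
      = fraction R M (a \<otimes> s' \<oplus> r' \<otimes> t) (t \<otimes> s')"
    if "a \<in> carrier R" "t \<in> M" for a t
    by (rule UN_fraction; (rule cong)?) (use that R M in auto)
  then have "(\<Union>(a, t)\<in>fraction R M r s.
        \<Union>(a', t')\<in>fraction R M r' s'. fraction R M (a \<otimes> t' \<oplus> a' \<otimes> t) (t \<otimes> t'))
      = (\<Union>(a, t)\<in>fraction R M r s. fraction R M (a \<otimes> s' \<oplus> r' \<otimes> t) (t \<otimes> s'))"
    by (intro SUP_cong refl) (auto dest: fraction_mem)
  also have "\<dots> = fraction R M (r \<otimes> s' \<oplus> r' \<otimes> s) (s \<otimes> s')"
    by (rule UN_fraction; (rule cong)?) (use R M in auto)
  finally show ?thesis
    by (simp add: localization_def)
qed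

end

lemma (in primeideal) mult_subset_Diff: "mult_subset (carrier R - I) R"
proof (intro mult_subset.intro is_cring submonoid.intro)
  show "\<one> \<in> carrier R - I"
    using one_imp_carrier I_notcarr by auto
qed (use I_prime in auto)

text \<open>The simplification rule \<open>kernel_zero\<close> leaves both rings of its premise schematic and makes
  the simplifier diverge on goals that mention \<open>h\<close>.\<close>

declare (in abelian_group_hom) kernel_zero [simp del]

section \<open>Localizations and prime ideals under a surjective homomorphism\<close>

context ring_hom_cring
begin

text \<open>Every kernel element is killed by some element of \<open>M\<close>, hence vanishes after
  localization; so \<open>h\<close> loses nothing there, and surjectivity passes to
  fractions.\<close>

theorem localization_iso_image:
  assumes surj: "h ` carrier R = carrier S" and M: "submonoid M R"
    and ker: "\<And>k. k \<in> a_kernel R S h \<Longrightarrow> \<exists>u\<in>M. u \<otimes> k = \<zero>"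
  shows "localization R M \<simeq> localization S (h ` M)"
proof -
  interpret M: mult_subset M R
    by (intro mult_subset.intro M R.is_cring)
  interpret N: mult_subset "h ` M" S
  proof (intro mult_subset.intro S.is_cring submonoid.intro)
    show "x \<otimes>\<^bsub>S\<^esub> y \<in> h ` M" if xy: "x \<in> h ` M" "y \<in> h ` M" for x y
    proof -
      obtain a b where "x = h a" "a \<in> M" "y = h b" "b \<in> M"
        using xy by blast
      then show ?thesis
        by (intro image_eqI[of _ h "a \<otimes> b"]) (simp_all add: M.mem_carrier)
    qed
    show "\<one>\<^bsub>S\<^esub> \<in> h ` M"
      using imageI[OF M.one_closed, of h] unfolding hom_one .
  qed (auto simp: M.mem_carrier)
  have eq_iff: "fraction S (h ` M) (h r) (h s) = fraction S (h ` M) (h r') (h s')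
      \<longleftrightarrow> fraction R M r s = fraction R M r' s'"
    if R: "r \<in> carrier R" "r' \<in> carrier R" and M: "s \<in> M" "s' \<in> M" for r r' s s'
  proof -
    note [simp] = R M M[THEN M.mem_carrier]
    have "(\<exists>u\<in>M. h u \<otimes>\<^bsub>S\<^esub> (h r \<otimes>\<^bsub>S\<^esub> h s') = h u \<otimes>\<^bsub>S\<^esub> (h r' \<otimes>\<^bsub>S\<^esub> h s))
        \<longleftrightarrow> (\<exists>u\<in>M. u \<otimes> (r \<otimes> s') = u \<otimes> (r' \<otimes> s))" (is "?l \<longleftrightarrow> ?r")
    proof
      assume ?l
      then obtain u where u: "u \<in> M"
        and hu: "h u \<otimes>\<^bsub>S\<^esub> (h r \<otimes>\<^bsub>S\<^esub> h s') = h u \<otimes>\<^bsub>S\<^esub> (h r' \<otimes>\<^bsub>S\<^esub> h s)"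
        by blast
      note [simp] = M.mem_carrier[OF u]
      have eq: "h (u \<otimes> (r \<otimes> s')) = h (u \<otimes> (r' \<otimes> s))"
        by (simp add: hu)
      \<comment> \<open>Equality in \<open>S\<close> only says that the difference lies in the
        kernel. Some \<open>v\<close> in \<open>M\<close> annihilates it, so
        \<open>v \<otimes> u\<close> is a witness in \<open>R\<close>.\<close>
      have "u \<otimes> (r \<otimes> s') \<ominus> u \<otimes> (r' \<otimes> s) \<in> a_kernel R S h"
        using eq by (simp add: a_kernel_def' a_minus_def S.r_neg del: hom_mult)
      then obtain v where v: "v \<in> M" and v0: "v \<otimes> (u \<otimes> (r \<otimes> s') \<ominus> u \<otimes> (r' \<otimes> s)) = \<zero>"
        using ker by blast
      note [simp] = M.mem_carrier[OF v]
      have "(v \<otimes> u) \<otimes> (r \<otimes> s') \<ominus> (v \<otimes> u) \<otimes> (r' \<otimes> s) = \<zero>"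
        using v0 by (simp add: R.m_assoc a_minus_def R.r_distr R.r_minus)
      then have "(v \<otimes> u) \<otimes> (r \<otimes> s') = (v \<otimes> u) \<otimes> (r' \<otimes> s)"
        by (simp add: R.r_right_minus_eq)
      then show ?r
        using u v by (intro bexI[of _ "v \<otimes> u"] M.m_closed)
    next
      assume ?r
      then obtain u where u: "u \<in> M" and eq: "u \<otimes> (r \<otimes> s') = u \<otimes> (r' \<otimes> s)"
        by blast
      have "h (u \<otimes> (r \<otimes> s')) = h (u \<otimes> (r' \<otimes> s))"
        by (simp only: eq)
      then show ?l
        using u by (intro bexI[of _ u]) (simp_all add: M.mem_carrier)
    qed
    then show ?thesis
      by (simp add: M.fraction_eq_iff N.fraction_eq_iff)
  qed
  \<comment> \<open>The map sends r/s to h(r)/h(s). Read from right to left, \<open>eq_iff\<close>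
    makes it well defined; read from left to right, it makes it injective.\<close>
  define \<phi> where "\<phi> X = (\<Union>(r, s)\<in>X. fraction S (h ` M) (h r) (h s))" for X
  have \<phi>: "\<phi> (fraction R M r s) = fraction S (h ` M) (h r) (h s)"
    if "r \<in> carrier R" "s \<in> M" for r s
    unfolding \<phi>_def using that eq_iff
    by (intro M.UN_fraction[where F = "\<lambda>r s. fraction S (h ` M) (h r) (h s)"]) simp_all
  have "\<phi> \<in> ring_iso (localization R M) (localization S (h ` M))"
  proof (rule ring_iso_memI)
    fix x assume "x \<in> carrier (localization R M)"
    then obtain r s where x: "x = fraction R M r s" "r \<in> carrier R" "s \<in> M"
      unfolding M.carrier_localization by blast
    then show "\<phi> x \<in> carrier (localization S (h ` M))"
      unfolding N.carrier_localization by (auto simp: \<phi>)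
    fix y assume "y \<in> carrier (localization R M)"
    then obtain r' s' where y: "y = fraction R M r' s'" "r' \<in> carrier R" "s' \<in> M"
      unfolding M.carrier_localization by blast
    show "\<phi> (x \<otimes>\<^bsub>localization R M\<^esub> y) = \<phi> x \<otimes>\<^bsub>localization S (h ` M)\<^esub> \<phi> y"
      using x y by (simp add: \<phi> M.mult_fraction N.mult_fraction M.mem_carrier)
    show "\<phi> (x \<oplus>\<^bsub>localization R M\<^esub> y) = \<phi> x \<oplus>\<^bsub>localization S (h ` M)\<^esub> \<phi> y"
      using x y by (simp add: \<phi> M.add_fraction N.add_fraction M.mem_carrier)
  next
    show "\<phi> \<one>\<^bsub>localization R M\<^esub> = \<one>\<^bsub>localization S (h ` M)\<^esub>"
      by (simp add: localization_def \<phi>)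
    have "inj_on \<phi> (carrier (localization R M))"
      unfolding M.carrier_localization by (rule inj_onI) (auto simp: \<phi> eq_iff)
    moreover have "\<phi> ` carrier (localization R M) = carrier (localization S (h ` M))"
    proof -
      have "carrier (localization S (h ` M))
          = {fraction S (h ` M) (h r) (h s) | r s. r \<in> carrier R \<and> s \<in> M}"
        unfolding N.carrier_localization surj[symmetric] by blast
      also have "\<dots> = {\<phi> (fraction R M r s) | r s. r \<in> carrier R \<and> s \<in> M}"
        using \<phi> by metis
      also have "\<dots> = \<phi> ` carrier (localization R M)"
        unfolding M.carrier_localization by blast
      finally show ?thesis ..
    qed
    ultimately show "bij_betw \<phi> (carrier (localization R M)) (carrier (localization S (h ` M)))"
      by (rule bij_betw_imageI)
  qed
  then show ?thesis
    by (auto simp: is_ring_iso_def)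
qed

text \<open>The single element \<open>u\<close> lies outside the pulled-back prime and annihilates
  the whole kernel, so it serves as the witness for every \<open>k\<close>. By surjectivity the
  complement of the pullback is mapped onto the complement of \<open>L\<close>.\<close>

corollary localization_at_iso_vimage:
  assumes surj: "h ` carrier R = carrier S" and L: "primeideal L S"
    and u: "u \<in> carrier R" "h u \<notin> L" "\<And>k. k \<in> a_kernel R S h \<Longrightarrow> u \<otimes> k = \<zero>"
  shows "localization_at R {r \<in> carrier R. h r \<in> L} \<simeq> localization_at S L"
proof -
  let ?P = "{r \<in> carrier R. h r \<in> L}"
  have "primeideal ?P R"
    by (rule ring.primeideal_vimage[OF R.is_cring L])
  then have "submonoid (carrier R - ?P) R"
    using primeideal.mult_subset_Diff mult_subset.axioms(2) by blast
  then have "localization R (carrier R - ?P) \<simeq> localization S (h ` (carrier R - ?P))"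
    using u by (intro localization_iso_image[OF surj]) blast+
  moreover have "h ` (carrier R - ?P) = carrier S - L"
    unfolding surj[symmetric] by blast
  ultimately show ?thesis
    by (simp add: localization_at_def)
qed

text \<open>If \<open>h r = h p\<close> with \<open>p\<close> in \<open>P\<close>, then
  \<open>r\<close> differs from \<open>p\<close> by a kernel element, which lies in \<open>P\<close>
  as well.\<close>

lemma vimage_image_kernel_subset:
  assumes P: "ideal P R" and ker: "a_kernel R S h \<subseteq> P"
  shows "{r \<in> carrier R. h r \<in> h ` P} = P"
proof -
  interpret P: ideal P R by (fact P)
  have "r \<in> P" if r: "r \<in> carrier R" and p: "p \<in> P" and eq: "h r = h p" for r p
  proof -
    note [simp] = r P.Icarr[OF p]
    have "r \<ominus> p \<in> a_kernel R S h"
      using eq by (simp add: a_kernel_def' a_minus_def S.r_neg)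
    then have "(r \<ominus> p) \<oplus> p \<in> P"
      using ker p by (intro P.a_closed) auto
    then show ?thesis
      by (simp add: a_minus_def R.a_assoc R.l_neg)
  qed
  then show ?thesis
    using P.Icarr by auto
qed

lemma primeideal_image:
  assumes surj: "h ` carrier R = carrier S" and P: "primeideal P R" and ker: "a_kernel R S h \<subseteq> P"
  shows "primeideal (h ` P) S"
proof -
  interpret P: primeideal P R by (fact P)
  have mem: "r \<in> P" if "r \<in> carrier R" "h r \<in> h ` P" for r
    using that vimage_image_kernel_subset[OF P.is_ideal ker] by blast
  show ?thesis
  proof (rule primeidealI)
    show "ideal (h ` P) S"
    proof (rule idealI)
      show "subgroup (h ` P) (add_monoid S)"
        by (rule ring.img_is_add_subgroup) (rule P.a_subgroup)
      fix a x assume "a \<in> h ` P" "x \<in> carrier S"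
      then obtain p r where "a = h p" "p \<in> P" "x = h r" "r \<in> carrier R"
        unfolding surj[symmetric] by blast
      then show "x \<otimes>\<^bsub>S\<^esub> a \<in> h ` P" "a \<otimes>\<^bsub>S\<^esub> x \<in> h ` P"
        using image_eqI[of _ h "r \<otimes> p" P] image_eqI[of _ h "p \<otimes> r" P]
        by (simp_all add: P.I_l_closed P.I_r_closed P.Icarr)
    qed (rule S.ring_axioms)
    show "carrier S \<noteq> h ` P"
      using P.I_notcarr P.Icarr mem surj by blast
    fix a b assume ab: "a \<in> carrier S" "b \<in> carrier S" "a \<otimes>\<^bsub>S\<^esub> b \<in> h ` P"
    then obtain r s where rs: "a = h r" "r \<in> carrier R" "b = h s" "s \<in> carrier R"
      unfolding surj[symmetric] by blast
    then have "r \<otimes> s \<in> P"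
      using ab(3) by (intro mem) auto
    then show "a \<in> h ` P \<or> b \<in> h ` P"
      using P.I_prime rs by blast
  qed (rule S.is_cring)
qed

end


subsection \<open>Bi-amalgamations\<close>

lemma (in ideal) add_mem_iff:
  assumes x: "x \<in> carrier R" and i: "i \<in> I"
  shows "x \<oplus> i \<in> I \<longleftrightarrow> x \<in> I"
proof
  assume "x \<oplus> i \<in> I"
  then have "(x \<oplus> i) \<oplus> \<ominus> i \<in> I"
    using additive_subgroup.a_closed additive_subgroup.a_inv_closed additive_subgroup_axioms i by metis
  then show "x \<in> I"
    using x Icarr[OF i] by (simp add: a_assoc r_neg)
qed (use i additive_subgroup.a_closed additive_subgroup_axioms in metis)

text \<open>Besides the two component rings, this covers the bi-amalgamation itself, by taking the
  product of \<open>B\<close> and \<open>C\<close> as the target ring.\<close>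

lemma cring_image_plus:
  assumes "cring A" "cring B" "f \<in> ring_hom A B" "ideal J B"
  shows "cring (image_plus A B f J)"
proof -
  interpret f: ring_hom_cring A B f
    by (intro ring_hom_cring.intro ring_hom_cring_axioms.intro assms)
  interpret J: ideal J B by fact
  let ?H = "{f a \<oplus>\<^bsub>B\<^esub> j | a j. a \<in> carrier A \<and> j \<in> J}"
  have "subring ?H B"
  proof (rule f.S.subringI)
    show "\<one>\<^bsub>B\<^esub> \<in> ?H"
      by (intro CollectI exI[of _ "\<one>\<^bsub>A\<^esub>"] exI[of _ "\<zero>\<^bsub>B\<^esub>"]) simp
  next
    fix x assume "x \<in> ?H"
    then obtain a j where "x = f a \<oplus>\<^bsub>B\<^esub> j" "a \<in> carrier A" "j \<in> J" by blast
    then show "\<ominus>\<^bsub>B\<^esub> x \<in> ?H"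
      by (intro CollectI exI[of _ "\<ominus>\<^bsub>A\<^esub> a"] exI[of _ "\<ominus>\<^bsub>B\<^esub> j"])
        (simp add: J.Icarr f.S.minus_add)
  next
    fix x y assume "x \<in> ?H" "y \<in> ?H"
    then obtain a j b k where [simp]: "x = f a \<oplus>\<^bsub>B\<^esub> j" "a \<in> carrier A" "j \<in> J"
        "y = f b \<oplus>\<^bsub>B\<^esub> k" "b \<in> carrier A" "k \<in> J"
      by blast
    have [simp]: "j \<in> carrier B" "k \<in> carrier B"
      by (simp_all add: J.Icarr)
    show "x \<oplus>\<^bsub>B\<^esub> y \<in> ?H"
      by (intro CollectI exI[of _ "a \<oplus>\<^bsub>A\<^esub> b"] exI[of _ "j \<oplus>\<^bsub>B\<^esub> k"]) (simp add: f.S.a_ac)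
    \<comment> \<open>Expanding the product leaves f(ab) plus terms containing \<open>j\<close> or
      \<open>k\<close>; these are absorbed by the ideal and form the new
      \<open>J\<close>-component.\<close>
    show "x \<otimes>\<^bsub>B\<^esub> y \<in> ?H"
      by (intro CollectI exI[of _ "a \<otimes>\<^bsub>A\<^esub> b"]
          exI[of _ "f a \<otimes>\<^bsub>B\<^esub> k \<oplus>\<^bsub>B\<^esub> j \<otimes>\<^bsub>B\<^esub> (f b \<oplus>\<^bsub>B\<^esub> k)"])
        (simp add: J.I_l_closed J.I_r_closed f.S.l_distr f.S.r_distr f.S.a_ac)
  qed (auto simp: J.Icarr)
  then have "subcring ?H B"
    by (rule f.S.subcringI')
  then show ?thesis
    unfolding image_plus_def using f.S.subcring_iff subcringE(1) by blast
qed

lemma RDirProd_simps [simp]: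
  "mult (RDirProd B C) = (\<lambda>(b, c) (b', c'). (b \<otimes>\<^bsub>B\<^esub> b', c \<otimes>\<^bsub>C\<^esub> c'))"
  "add (RDirProd B C) = (\<lambda>(b, c) (b', c'). (b \<oplus>\<^bsub>B\<^esub> b', c \<oplus>\<^bsub>C\<^esub> c'))"
  "one (RDirProd B C) = (\<one>\<^bsub>B\<^esub>, \<one>\<^bsub>C\<^esub>)"
  "zero (RDirProd B C) = (\<zero>\<^bsub>B\<^esub>, \<zero>\<^bsub>C\<^esub>)"
  by (simp_all add: RDirProd_def DirProd_def monoid.defs)

lemma RDirProd_cring:
  assumes "cring B" "cring C"
  shows "cring (RDirProd B C)"
proof -
  interpret B: cring B by fact
  interpret C: cring C by fact
  interpret ring "RDirProd B C"
    by (intro RDirProd_ring B.ring_axioms C.ring_axioms)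
  show ?thesis
    by unfold_locales (auto simp: RDirProd_carrier B.m_comm C.m_comm)
qed

lemma bi_amalg_simps [simp]:
  "carrier (bi_amalg A B C f g J J') = bi_amalg_set B C f g (carrier A) J J'"
  "mult (bi_amalg A B C f g J J') = mult (RDirProd B C)"
  "add (bi_amalg A B C f g J J') = add (RDirProd B C)"
  "one (bi_amalg A B C f g J J') = one (RDirProd B C)"
  "zero (bi_amalg A B C f g J J') = zero (RDirProd B C)"
  by (simp_all add: bi_amalg_def)

lemma image_plus_simps [simp]:
  "carrier (image_plus A B f J) = {f a \<oplus>\<^bsub>B\<^esub> j | a j. a \<in> carrier A \<and> j \<in> J}"
  "mult (image_plus A B f J) = mult B"
  "add (image_plus A B f J) = add B"
  "one (image_plus A B f J) = one B"
  "zero (image_plus A B f J) = zero B"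
  by (simp_all add: image_plus_def)

text \<open>The diagonal map makes the bi-amalgamation itself an instance of the construction
  \<open>f(A) + J\<close>, with the ideal \<open>J \<times> J'\<close> of \<open>B \<times> C\<close>.\<close>

lemma bi_amalg_eq_image_plus:
  "bi_amalg A B C f g J J' = image_plus A (RDirProd B C) (\<lambda>a. (f a, g a)) (J \<times> J')"
  by (simp add: bi_amalg_def image_plus_def bi_amalg_set_def)

lemma Spec_subset: "L \<in> Spec T \<Longrightarrow> L \<subseteq> carrier T"
  unfolding Spec_def by (blast dest: primeideal.axioms(1) ideal.Icarr)

section \<open>The projections of the bi-amalgamation and their kernels\<close>

locale bi_amalgamation =
  f: ring_hom_cring A B f + g: ring_hom_cring A C g + J: ideal J B + J': ideal J' C
  for A (structure) and B (structure) and C (structure) and f g J J' +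
  assumes J_iff_J': "a \<in> carrier A \<Longrightarrow> f a \<in> J \<longleftrightarrow> g a \<in> J'"
begin

abbreviation "R \<equiv> bi_amalg A B C f g J J'"
abbreviation "S \<equiv> image_plus A B f J"
abbreviation "S' \<equiv> image_plus A C g J'"

lemma mem_R: "a \<in> carrier A \<Longrightarrow> j \<in> J \<Longrightarrow> j' \<in> J' \<Longrightarrow> (f a \<oplus>\<^bsub>B\<^esub> j, g a \<oplus>\<^bsub>C\<^esub> j') \<in> carrier R"
  by (auto simp: bi_amalg_set_def)

lemma R_E:
  assumes "x \<in> carrier R"
  obtains a j j' where "x = (f a \<oplus>\<^bsub>B\<^esub> j, g a \<oplus>\<^bsub>C\<^esub> j')" "a \<in> carrier A" "j \<in> J" "j' \<in> J'"
  using assms by (auto simp: bi_amalg_set_def)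

lemma JJ'_R: "J \<times> J' \<subseteq> carrier R"
proof clarify
  fix j j' assume "j \<in> J" "j' \<in> J'"
  then show "(j, j') \<in> carrier R"
    using mem_R[of "\<zero>\<^bsub>A\<^esub>" j j'] by (simp add: J.Icarr J'.Icarr del: bi_amalg_simps)
qed

lemma diag_R: "a \<in> carrier A \<Longrightarrow> (f a, g a) \<in> carrier R"
  using mem_R[of a "\<zero>\<^bsub>B\<^esub>" "\<zero>\<^bsub>C\<^esub>"] by (simp del: bi_amalg_simps)

lemma surj_fst: "fst ` carrier R = carrier S"
  proof
  show "carrier S \<subseteq> fst ` carrier R"
    using mem_R[OF _ _ J'.zero_closed] by (force simp del: bi_amalg_simps)
  show "fst ` carrier R \<subseteq> carrier S"
    unfolding bi_amalg_simps image_plus_simps bi_amalg_set_def by (clarify, unfold fst_conv, blast)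
qed

lemma surj_snd: "snd ` carrier R = carrier S'"
  proof
  show "carrier S' \<subseteq> snd ` carrier R"
    using mem_R[OF _ J.zero_closed] by (force simp del: bi_amalg_simps)
  show "snd ` carrier R \<subseteq> carrier S'"
    unfolding bi_amalg_simps image_plus_simps bi_amalg_set_def by (clarify, unfold snd_conv, blast)
qed

lemma cring_R: "cring R"
proof -
  interpret BC: cring "RDirProd B C"
    by (intro RDirProd_cring f.S.is_cring g.S.is_cring)
  have "(\<lambda>a. (f a, g a)) \<in> ring_hom A (RDirProd B C)"
    by (rule ring_hom_memI) (auto simp: RDirProd_carrier)
  moreover have "ideal (J \<times> J') (RDirProd B C)"
  proof (rule idealI)
    show "subgroup (J \<times> J') (add_monoid (RDirProd B C))"
      using DirProd_subgroups[OF f.S.add.is_group J.a_subgroup g.S.add.is_group J'.a_subgroup]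
      by (simp only: RDirProd_add_monoid)
  qed (auto simp: RDirProd_carrier J.I_l_closed J.I_r_closed J'.I_l_closed J'.I_r_closed
      intro: BC.ring_axioms)
  ultimately show ?thesis
    unfolding bi_amalg_eq_image_plus
    by (intro cring_image_plus f.R.is_cring BC.is_cring)
qed

sublocale fst: ring_hom_cring R S fst
proof (intro ring_hom_cring.intro ring_hom_cring_axioms.intro cring_R)
  show "cring S"
    by (intro cring_image_plus f.R.is_cring f.S.is_cring f.homh J.is_ideal)
  show "fst \<in> ring_hom R S"
  proof (rule ring_hom_memI)
    show "fst x \<in> carrier S" if "x \<in> carrier R" for x
      using that surj_fst by blast
  qed auto
qed

sublocale snd: ring_hom_cring R S' snd
proof (intro ring_hom_cring.intro ring_hom_cring_axioms.intro cring_R)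
  show "cring S'"
    by (intro cring_image_plus f.R.is_cring g.S.is_cring g.homh J'.is_ideal)
  show "snd \<in> ring_hom R S'"
  proof (rule ring_hom_memI)
    show "snd x \<in> carrier S'" if "x \<in> carrier R" for x
      using that surj_snd by blast
  qed auto
qed

text \<open>Dropping the summands \<open>j\<close> and \<open>j'\<close> does not affect membership,
  so both sides reduce to \<open>f a \<in> J\<close> and \<open>g a \<in> J'\<close>. These agree
  because the two ideals have the same preimage in \<open>A\<close>.\<close>

lemma fst_mem_J_iff:
  assumes "x \<in> carrier R"
  shows "fst x \<in> J \<longleftrightarrow> snd x \<in> J'"
proof -
  obtain a j j' where x: "x = (f a \<oplus>\<^bsub>B\<^esub> j, g a \<oplus>\<^bsub>C\<^esub> j')" "a \<in> carrier A" "j \<in> J" "j' \<in> J'"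
    using assms by (rule R_E)
  then show ?thesis
    using J_iff_J' by (simp add: J.add_mem_iff J'.add_mem_iff)
qed

lemma kernel_fst: "a_kernel R S fst = {\<zero>\<^bsub>B\<^esub>} \<times> J'"
proof -
  \<comment> \<open>A vanishing first component lies in \<open>J\<close>, which forces the second
    one into \<open>J'\<close>.\<close>
  have "x \<in> {\<zero>\<^bsub>B\<^esub>} \<times> J'" if "x \<in> carrier R" "fst x = \<zero>\<^bsub>B\<^esub>" for x
    using fst_mem_J_iff[OF that(1)] that(2) by (cases x) simp
  then show ?thesis
    using JJ'_R by (auto simp: a_kernel_def')
qed

lemma kernel_snd: "a_kernel R S' snd = J \<times> {\<zero>\<^bsub>C\<^esub>}"
proof -
  have "x \<in> J \<times> {\<zero>\<^bsub>C\<^esub>}" if "x \<in> carrier R" "snd x = \<zero>\<^bsub>C\<^esub>" for x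
    using fst_mem_J_iff[OF that(1)] that(2) by (cases x) simp
  then show ?thesis
    using JJ'_R by (auto simp: a_kernel_def')
qed

lemma bar_fst_eq: "bar_fst A B C f g J J' L = {x \<in> carrier R. fst x \<in> L}"
  \<comment> \<open>The condition on the second component holds automatically, because
    \<open>snd\<close> maps \<open>R\<close> into \<open>S'\<close>.\<close>
  using surj_snd by (force simp: bar_fst_def simp del: bi_amalg_simps image_plus_simps)

lemma bar_snd_eq: "bar_snd A B C f g J J' L = {x \<in> carrier R. snd x \<in> L}"
  using surj_fst by (force simp: bar_snd_def simp del: bi_amalg_simps image_plus_simps)

lemma bar_fst_Spec: "L \<in> Spec S \<Longrightarrow> bar_fst A B C f g J J' L \<in> Spec R"
  unfolding bar_fst_eq Spec_def using fst.ring.primeideal_vimage[OF cring_R] by blast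

lemma bar_snd_Spec: "L \<in> Spec S' \<Longrightarrow> bar_snd A B C f g J J' L \<in> Spec R"
  unfolding bar_snd_eq Spec_def using snd.ring.primeideal_vimage[OF cring_R] by blast

text \<open>Surjectivity of \<open>fst\<close> recovers \<open>L\<close> from its bar; this is the
  source of the uniqueness of \<open>L\<close>.\<close>

lemma fst_bar_fst: "L \<in> Spec S \<Longrightarrow> fst ` bar_fst A B C f g J J' L = L"
  unfolding bar_fst_eq using Spec_subset[of L S] unfolding surj_fst[symmetric] by blast

lemma snd_bar_snd: "L \<in> Spec S' \<Longrightarrow> snd ` bar_snd A B C f g J J' L = L"
  unfolding bar_snd_eq using Spec_subset[of L S'] unfolding surj_snd[symmetric] by blast

lemma JJ'_subset_bar_fst: "J \<times> J' \<subseteq> bar_fst A B C f g J J' L \<longleftrightarrow> J \<subseteq> L"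
proof -
  have "J \<times> J' \<subseteq> bar_fst A B C f g J J' L \<longleftrightarrow> fst ` (J \<times> J') \<subseteq> L"
    unfolding bar_fst_eq using JJ'_R by blast
  also have "fst ` (J \<times> J') = J"
    \<comment> \<open>The zero of \<open>J'\<close> rules out the degenerate case in which the
      product, and with it the projection, would be empty.\<close>
    using J'.zero_closed by (simp only: fst_image_times split: if_split) blast
  finally show ?thesis .
qed

lemma JJ'_subset_bar_snd: "J \<times> J' \<subseteq> bar_snd A B C f g J J' L \<longleftrightarrow> J' \<subseteq> L"
proof -
  have "J \<times> J' \<subseteq> bar_snd A B C f g J J' L \<longleftrightarrow> snd ` (J \<times> J') \<subseteq> L"
    unfolding bar_snd_eq using JJ'_R by blast
  also have "snd ` (J \<times> J') = J'"
    using J.zero_closed by (simp only: snd_image_times split: if_split) blast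
  finally show ?thesis .
qed

text \<open>The correspondence theorem for the first projection: a prime containing its kernel is
  the pullback of its own image.\<close>

lemma Spec_kernel_fst:
  assumes "P \<in> Spec R" "{\<zero>\<^bsub>B\<^esub>} \<times> J' \<subseteq> P"
  shows "fst ` P \<in> Spec S" "P = bar_fst A B C f g J J' (fst ` P)"
proof -
  have P: "primeideal P R"
    using assms(1) by (simp add: Spec_def)
  show "fst ` P \<in> Spec S"
    using fst.primeideal_image[OF surj_fst P] assms(2) by (simp add: kernel_fst Spec_def)
  show "P = bar_fst A B C f g J J' (fst ` P)"
    unfolding bar_fst_eq
    using fst.vimage_image_kernel_subset[OF primeideal.axioms(1)[OF P]] assms(2)
    by (simp add: kernel_fst)
qed

lemma Spec_kernel_snd:
  assumes "P \<in> Spec R" "J \<times> {\<zero>\<^bsub>C\<^esub>} \<subseteq> P"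
  shows "snd ` P \<in> Spec S'" "P = bar_snd A B C f g J J' (snd ` P)"
proof -
  have P: "primeideal P R"
    using assms(1) by (simp add: Spec_def)
  show "snd ` P \<in> Spec S'"
    using snd.primeideal_image[OF surj_snd P] assms(2) by (simp add: kernel_snd Spec_def)
  show "P = bar_snd A B C f g J J' (snd ` P)"
    unfolding bar_snd_eq
    using snd.vimage_image_kernel_subset[OF primeideal.axioms(1)[OF P]] assms(2)
    by (simp add: kernel_snd)
qed

lemma kernel_subset_bar_fst: "L \<in> Spec S \<Longrightarrow> {\<zero>\<^bsub>B\<^esub>} \<times> J' \<subseteq> bar_fst A B C f g J J' L"
proof -
  assume "L \<in> Spec S"
  then have "\<zero>\<^bsub>S\<^esub> \<in> L"
    unfolding Spec_def by (blast dest: primeideal.axioms(1) ideal.axioms(1) additive_subgroup.zero_closed)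
  then show ?thesis
    unfolding bar_fst_eq kernel_fst[symmetric] a_kernel_def' by auto
qed

lemma kernel_subset_bar_snd: "L \<in> Spec S' \<Longrightarrow> J \<times> {\<zero>\<^bsub>C\<^esub>} \<subseteq> bar_snd A B C f g J J' L"
proof -
  assume "L \<in> Spec S'"
  then have "\<zero>\<^bsub>S'\<^esub> \<in> L"
    unfolding Spec_def by (blast dest: primeideal.axioms(1) ideal.axioms(1) additive_subgroup.zero_closed)
  then show ?thesis
    unfolding bar_snd_eq kernel_snd[symmetric] a_kernel_def' by auto
qed

lemma Spec_cases:
  assumes "P \<in> Spec R"
  obtains "{\<zero>\<^bsub>B\<^esub>} \<times> J' \<subseteq> P" | "J \<times> {\<zero>\<^bsub>C\<^esub>} \<subseteq> P"
proof -
  interpret P: primeideal P R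
    using assms by (simp add: Spec_def)
  have "(j, \<zero>\<^bsub>C\<^esub>) \<in> P" if j: "j \<in> J" and j': "j' \<in> J'" "(\<zero>\<^bsub>B\<^esub>, j') \<notin> P" for j j'
  proof -
    have "(j, \<zero>\<^bsub>C\<^esub>) \<otimes>\<^bsub>R\<^esub> (\<zero>\<^bsub>B\<^esub>, j') = \<zero>\<^bsub>R\<^esub>"
      using j j' by (simp add: J.Icarr J'.Icarr)
    then have "(j, \<zero>\<^bsub>C\<^esub>) \<otimes>\<^bsub>R\<^esub> (\<zero>\<^bsub>B\<^esub>, j') \<in> P"
      using P.zero_closed by simp
    moreover have "(j, \<zero>\<^bsub>C\<^esub>) \<in> carrier R" "(\<zero>\<^bsub>B\<^esub>, j') \<in> carrier R"
      using j j' JJ'_R J.zero_closed J'.zero_closed by blast+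
    ultimately show ?thesis
      using P.I_prime j'(2) by blast
  qed
  then show ?thesis
    using that by fastforce
qed

text \<open>The set \<open>J \<times> J'\<close> is the sum of the two kernels, as (j, j') = (j, 0)
  + (0, j').\<close>

lemma JJ'_subset_iff_kernels:
  assumes "P \<in> Spec R"
  shows "J \<times> J' \<subseteq> P \<longleftrightarrow> {\<zero>\<^bsub>B\<^esub>} \<times> J' \<subseteq> P \<and> J \<times> {\<zero>\<^bsub>C\<^esub>} \<subseteq> P"
proof
  interpret P: primeideal P R
    using assms by (simp add: Spec_def)
  assume *: "{\<zero>\<^bsub>B\<^esub>} \<times> J' \<subseteq> P \<and> J \<times> {\<zero>\<^bsub>C\<^esub>} \<subseteq> P"
  show "J \<times> J' \<subseteq> P"
  proof clarify
    fix j j' assume j: "j \<in> J" "j' \<in> J'"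
    then have "(j, \<zero>\<^bsub>C\<^esub>) \<oplus>\<^bsub>R\<^esub> (\<zero>\<^bsub>B\<^esub>, j') \<in> P"
      using * by (intro P.a_closed) auto
    then show "(j, j') \<in> P"
      using j by (simp add: J.Icarr J'.Icarr)
  qed
qed (use J.zero_closed J'.zero_closed in auto)

lemma Spec_eq:
  "Spec R = bar_fst A B C f g J J' ` Spec S \<union> bar_snd A B C f g J J' ` Spec S'"
proof
  show "Spec R \<subseteq> bar_fst A B C f g J J' ` Spec S \<union> bar_snd A B C f g J J' ` Spec S'"
  proof
    fix P assume P: "P \<in> Spec R"
    then show "P \<in> bar_fst A B C f g J J' ` Spec S \<union> bar_snd A B C f g J J' ` Spec S'"
    proof (cases rule: Spec_cases)
      case 1
      then show ?thesis
        using Spec_kernel_fst[OF P] by (intro UnI1 image_eqI)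
    next
      case 2
      then show ?thesis
        using Spec_kernel_snd[OF P] by (intro UnI2 image_eqI)
    qed
  qed
qed (intro Un_least image_subsetI bar_fst_Spec bar_snd_Spec)

section \<open>Primes not containing J x J' and their localizations\<close>

lemma localization_bar_fst:
  assumes "L \<in> Spec S" "\<not> J \<subseteq> L"
  shows "localization_at R (bar_fst A B C f g J J' L) \<simeq> localization_at S L"
proof -
  obtain j where j: "j \<in> J" "j \<notin> L"
    using assms(2) by blast
  show ?thesis
    unfolding bar_fst_eq
  proof (rule fst.localization_at_iso_vimage[OF surj_fst])
    show "primeideal L S"
      using assms(1) by (simp add: Spec_def)
    show "(j, \<zero>\<^bsub>C\<^esub>) \<in> carrier R"
      using j JJ'_R by auto
  qed (use j in \<open>auto simp: kernel_fst J.Icarr J'.Icarr\<close>)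
qed

lemma localization_bar_snd:
  assumes "L \<in> Spec S'" "\<not> J' \<subseteq> L"
  shows "localization_at R (bar_snd A B C f g J J' L) \<simeq> localization_at S' L"
proof -
  obtain j where j: "j \<in> J'" "j \<notin> L"
    using assms(2) by blast
  show ?thesis
    unfolding bar_snd_eq
  proof (rule snd.localization_at_iso_vimage[OF surj_snd])
    show "primeideal L S'"
      using assms(1) by (simp add: Spec_def)
    show "(\<zero>\<^bsub>B\<^esub>, j) \<in> carrier R"
      using j JJ'_R by auto
  qed (use j in \<open>auto simp: kernel_snd J.Icarr J'.Icarr\<close>)
qed

lemma ex1_bar_fst_iff:
  assumes "P \<in> Spec R"
  shows "(\<exists>!L. L \<in> Spec S \<and> \<not> J \<subseteq> L \<and> P = bar_fst A B C f g J J' L)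
    \<longleftrightarrow> \<not> J \<times> J' \<subseteq> P \<and> {\<zero>\<^bsub>B\<^esub>} \<times> J' \<subseteq> P"
proof
  assume "\<exists>!L. L \<in> Spec S \<and> \<not> J \<subseteq> L \<and> P = bar_fst A B C f g J J' L"
  then obtain L where "L \<in> Spec S" "\<not> J \<subseteq> L" "P = bar_fst A B C f g J J' L"
    by blast
  then show "\<not> J \<times> J' \<subseteq> P \<and> {\<zero>\<^bsub>B\<^esub>} \<times> J' \<subseteq> P"
    using kernel_subset_bar_fst JJ'_subset_bar_fst by simp
next
  assume asm: "\<not> J \<times> J' \<subseteq> P \<and> {\<zero>\<^bsub>B\<^esub>} \<times> J' \<subseteq> P"
  then have P: "fst ` P \<in> Spec S" "bar_fst A B C f g J J' (fst ` P) = P"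
    using Spec_kernel_fst[OF assms] by auto
  show "\<exists>!L. L \<in> Spec S \<and> \<not> J \<subseteq> L \<and> P = bar_fst A B C f g J J' L"
  proof (rule ex1I[of _ "fst ` P"])
    show "fst ` P \<in> Spec S \<and> \<not> J \<subseteq> fst ` P \<and> P = bar_fst A B C f g J J' (fst ` P)"
      using P asm JJ'_subset_bar_fst[of "fst ` P"] by simp
  qed (simp add: fst_bar_fst)
qed

lemma ex1_bar_snd_iff:
  assumes "P \<in> Spec R"
  shows "(\<exists>!L. L \<in> Spec S' \<and> \<not> J' \<subseteq> L \<and> P = bar_snd A B C f g J J' L)
    \<longleftrightarrow> \<not> J \<times> J' \<subseteq> P \<and> J \<times> {\<zero>\<^bsub>C\<^esub>} \<subseteq> P"
proof
  assume "\<exists>!L. L \<in> Spec S' \<and> \<not> J' \<subseteq> L \<and> P = bar_snd A B C f g J J' L"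
  then obtain L where "L \<in> Spec S'" "\<not> J' \<subseteq> L" "P = bar_snd A B C f g J J' L"
    by blast
  then show "\<not> J \<times> J' \<subseteq> P \<and> J \<times> {\<zero>\<^bsub>C\<^esub>} \<subseteq> P"
    using kernel_subset_bar_snd JJ'_subset_bar_snd by simp
next
  assume asm: "\<not> J \<times> J' \<subseteq> P \<and> J \<times> {\<zero>\<^bsub>C\<^esub>} \<subseteq> P"
  then have P: "snd ` P \<in> Spec S'" "bar_snd A B C f g J J' (snd ` P) = P"
    using Spec_kernel_snd[OF assms] by auto
  show "\<exists>!L. L \<in> Spec S' \<and> \<not> J' \<subseteq> L \<and> P = bar_snd A B C f g J J' L"
  proof (rule ex1I[of _ "snd ` P"])
    show "snd ` P \<in> Spec S' \<and> \<not> J' \<subseteq> snd ` P \<and> P = bar_snd A B C f g J J' (snd ` P)"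
      using P asm JJ'_subset_bar_snd[of "snd ` P"] by simp
  qed (simp add: snd_bar_snd)
qed

section \<open>Primes containing J x J' and their contractions to A\<close>

lemma diag_ring_hom: "(\<lambda>a. (f a, g a)) \<in> ring_hom A R"
  by (rule ring_hom_memI) (use diag_R in auto)

lemma ex1_bi_amalg_set_iff:
  assumes "P \<in> Spec R"
  shows "(\<exists>!p. p \<in> Spec A \<and> {a \<in> carrier A. f a \<in> J} \<subseteq> p \<and> P = bi_amalg_set B C f g p J J')
    \<longleftrightarrow> J \<times> J' \<subseteq> P"
proof
  assume "\<exists>!p. p \<in> Spec A \<and> {a \<in> carrier A. f a \<in> J} \<subseteq> p \<and> P = bi_amalg_set B C f g p J J'"
  then obtain p where p: "p \<in> Spec A" and P: "P = bi_amalg_set B C f g p J J'"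
    by blast
  interpret p: primeideal p A
    using p by (simp add: Spec_def)
  have "(f \<zero>\<^bsub>A\<^esub> \<oplus>\<^bsub>B\<^esub> j, g \<zero>\<^bsub>A\<^esub> \<oplus>\<^bsub>C\<^esub> j') \<in> P" if "j \<in> J" "j' \<in> J'" for j j'
    using that p.zero_closed unfolding P bi_amalg_set_def by blast
  then show "J \<times> J' \<subseteq> P"
    by (auto simp: J.Icarr J'.Icarr)
next
  assume JP: "J \<times> J' \<subseteq> P"
  interpret P: primeideal P R
    using assms by (simp add: Spec_def)
  \<comment> \<open>The candidate is the contraction of \<open>P\<close> along the diagonal map,
    hence prime.\<close>
  let ?p = "{a \<in> carrier A. (f a, g a) \<in> P}"
  interpret diag: ring_hom_ring A R "\<lambda>a. (f a, g a)"
    by (intro ring_hom_ringI2 f.R.ring_axioms cring.axioms(1)[OF cring_R] diag_ring_hom)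
  have p: "primeideal ?p A"
    by (rule diag.primeideal_vimage[OF f.R.is_cring P.primeideal])
  \<comment> \<open>The pair \<open>(j, j')\<close> lies in \<open>P\<close>, so adding it does not
    change membership.\<close>
  have P_iff: "(f a \<oplus>\<^bsub>B\<^esub> j, g a \<oplus>\<^bsub>C\<^esub> j') \<in> P \<longleftrightarrow> (f a, g a) \<in> P"
    if a: "a \<in> carrier A" and j: "j \<in> J" "j' \<in> J'" for a j j'
    using P.add_mem_iff[OF diag_R[OF a], of "(j, j')"] JP j by auto
  have P_eq: "P = bi_amalg_set B C f g ?p J J'"
  proof
    show "P \<subseteq> bi_amalg_set B C f g ?p J J'"
    proof
      fix x assume x: "x \<in> P"
      then obtain a j j' where "x = (f a \<oplus>\<^bsub>B\<^esub> j, g a \<oplus>\<^bsub>C\<^esub> j')" "a \<in> carrier A" "j \<in> J" "j' \<in> J'"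
        using P.Icarr R_E by metis
      then show "x \<in> bi_amalg_set B C f g ?p J J'"
        using x P_iff unfolding bi_amalg_set_def by blast
    qed
  qed (auto simp: bi_amalg_set_def P_iff)
  have uniq: "q = ?p" if q: "primeideal q A" and Io: "{a \<in> carrier A. f a \<in> J} \<subseteq> q"
    and Pq: "P = bi_amalg_set B C f g q J J'" for q
  proof -
    interpret q: primeideal q A by (fact q)
    have "(f a, g a) \<in> P" if "a \<in> q" for a
    proof -
      have "(f a \<oplus>\<^bsub>B\<^esub> \<zero>\<^bsub>B\<^esub>, g a \<oplus>\<^bsub>C\<^esub> \<zero>\<^bsub>C\<^esub>) \<in> P"
        unfolding Pq bi_amalg_set_def using that J.zero_closed J'.zero_closed by blast
      then show ?thesis
        using that by (simp add: q.Icarr)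
    qed
    moreover have "a \<in> q" if a: "a \<in> carrier A" and aP: "(f a, g a) \<in> P" for a
    proof -
      \<comment> \<open>The first component alone suffices: it gives f(a - i) = j, so a - i lies in
        the preimage of \<open>J\<close>, which is contained in \<open>q\<close>.\<close>
      obtain i j where i: "i \<in> q" "j \<in> J" "f a = f i \<oplus>\<^bsub>B\<^esub> j"
        using aP unfolding Pq bi_amalg_set_def by blast
      note [simp] = a q.Icarr[OF i(1)] J.Icarr[OF i(2)]
      have "f (a \<ominus>\<^bsub>A\<^esub> i) = \<ominus>\<^bsub>B\<^esub> f i \<oplus>\<^bsub>B\<^esub> (f i \<oplus>\<^bsub>B\<^esub> j)"
        unfolding i(3)[symmetric] by (simp add: a_minus_def f.S.a_comm)
      then have "f (a \<ominus>\<^bsub>A\<^esub> i) = j"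
        by (simp add: f.S.r_neg1)
      then have "a \<ominus>\<^bsub>A\<^esub> i \<in> q"
        using Io i(2) by auto
      then have "(a \<ominus>\<^bsub>A\<^esub> i) \<oplus>\<^bsub>A\<^esub> i \<in> q"
        using i(1) by (rule q.a_closed)
      then show ?thesis
        by (simp add: a_minus_def f.R.a_assoc f.R.l_neg)
    qed
    ultimately show ?thesis
      using q.Icarr by blast
  qed
  \<comment> \<open>If \<open>f a\<close> lies in \<open>J\<close>, then \<open>g a\<close> lies in
    \<open>J'\<close>, so the diagonal image of \<open>a\<close> lies in
    \<open>J \<times> J'\<close> and hence in \<open>P\<close>.\<close>
  have Io: "{a \<in> carrier A. f a \<in> J} \<subseteq> ?p"
    using JP J_iff_J' by blast
  show "\<exists>!p. p \<in> Spec A \<and> {a \<in> carrier A. f a \<in> J} \<subseteq> p \<and> P = bi_amalg_set B C f g p J J'"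
  proof (intro ex1I conjI)
    show "?p \<in> Spec A"
      unfolding Spec_def using p by (rule CollectI)
    show "q = ?p"
      if "q \<in> Spec A \<and> {a \<in> carrier A. f a \<in> J} \<subseteq> q \<and> P = bi_amalg_set B C f g q J J'" for q
      by (rule uniq) (use that in \<open>simp_all add: Spec_def\<close>)
  qed (fact Io P_eq)+
qed

text \<open>Such a prime contains both kernels, so it is the bar of each of its two
  projections.\<close>

lemma ex_bar_fst_bar_snd:
  assumes "P \<in> Spec R" "J \<times> J' \<subseteq> P"
  shows "\<exists>L \<in> Spec S. \<exists>L' \<in> Spec S'. J \<subseteq> L \<and> J' \<subseteq> L' \<and>
    P = bar_fst A B C f g J J' L \<and> P = bar_snd A B C f g J J' L'"
proof -
  have k: "{\<zero>\<^bsub>B\<^esub>} \<times> J' \<subseteq> P" "J \<times> {\<zero>\<^bsub>C\<^esub>} \<subseteq> P"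
    using assms JJ'_subset_iff_kernels by blast+
  note P = Spec_kernel_fst[OF assms(1) k(1)] Spec_kernel_snd[OF assms(1) k(2)]
  moreover have "J \<subseteq> fst ` P" "J' \<subseteq> snd ` P"
    using JJ'_subset_bar_fst[of "fst ` P"] JJ'_subset_bar_snd[of "snd ` P"] assms(2)
    by (simp_all flip: P(2,4))
  ultimately show ?thesis
    by blast
qed

end

theorem proposition5p3:
  fixes A :: "('a, 'm) ring_scheme"
    and B :: "('b, 'n) ring_scheme"
    and C :: "('c, 'k) ring_scheme"
    and f :: "'a \<Rightarrow> 'b" and g :: "'a \<Rightarrow> 'c"
    and J :: "'b set" and J' :: "'c set" and I\<^sub>o :: "'a set"
    and R :: "('b \<times> 'c) ring"
    and Y :: "'b set set" and Y' :: "'c set set"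
  assumes "cring A" and "cring B" and "cring C"
    and "f \<in> ring_hom A B" and "g \<in> ring_hom A C"
    and "ideal J B" and "ideal J' C"
    and "I\<^sub>o = {a \<in> carrier A. f a \<in> J}" and "I\<^sub>o = {a \<in> carrier A. g a \<in> J'}"
    and "R = bi_amalg A B C f g J J'"
    and "Y = Spec (image_plus A B f J)" and "Y' = Spec (image_plus A C g J')"
  shows
    "(\<forall>P \<in> Spec R.
        \<comment> \<open>(1)\<close>
        (J \<times> J' \<subseteq> P \<longleftrightarrow> (\<exists>!p. p \<in> Spec A \<and> I\<^sub>o \<subseteq> p \<and> P = bi_amalg_set B C f g p J J')) \<and>
        (J \<times> J' \<subseteq> P \<longrightarrow>
          (\<exists>L \<in> Y. \<exists>L' \<in> Y'. J \<subseteq> L \<and> J' \<subseteq> L' \<and>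
             P = bar_fst A B C f g J J' L \<and> P = bar_snd A B C f g J J' L')) \<and>
        \<comment> \<open>(2)\<close>
        (\<not> J \<times> J' \<subseteq> P \<longleftrightarrow>
          (\<exists>!L. L \<in> Y \<and> \<not> J \<subseteq> L \<and> P = bar_fst A B C f g J J' L) \<or>
          (\<exists>!L. L \<in> Y' \<and> \<not> J' \<subseteq> L \<and> P = bar_snd A B C f g J J' L)) \<and>
        \<not> ((\<exists>!L. L \<in> Y \<and> \<not> J \<subseteq> L \<and> P = bar_fst A B C f g J J' L) \<and>
           (\<exists>!L. L \<in> Y' \<and> \<not> J' \<subseteq> L \<and> P = bar_snd A B C f g J J' L)) \<and>
        (\<forall>L \<in> Y. \<not> J \<subseteq> L \<and> P = bar_fst A B C f g J J' L \<longrightarrow>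
           localization_at R P \<simeq> localization_at (image_plus A B f J) L) \<and>
        (\<forall>L \<in> Y'. \<not> J' \<subseteq> L \<and> P = bar_snd A B C f g J J' L \<longrightarrow>
           localization_at R P \<simeq> localization_at (image_plus A C g J') L)) \<and>
     Spec R = bar_fst A B C f g J J' ` Y \<union> bar_snd A B C f g J J' ` Y'"
proof -
  interpret bi_amalgamation A B C f g J J'
  proof (intro bi_amalgamation.intro bi_amalgamation_axioms.intro
      ring_hom_cring.intro ring_hom_cring_axioms.intro assms(1-7))
    show "f a \<in> J \<longleftrightarrow> g a \<in> J'" if "a \<in> carrier A" for a
      using that assms(8,9) by blast
  qed
  show ?thesis
    unfolding assms(10-12) assms(8)
  proof (intro conjI ballI impI Spec_eq)
    fix P assume P: "P \<in> Spec (bi_amalg A B C f g J J')"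
    note kernels = JJ'_subset_iff_kernels[OF P]
    show "J \<times> J' \<subseteq> P \<longleftrightarrow> (\<exists>!p. p \<in> Spec A \<and> {a \<in> carrier A. f a \<in> J} \<subseteq> p \<and>
        P = bi_amalg_set B C f g p J J')"
      by (rule ex1_bi_amalg_set_iff[OF P, symmetric])
    show "\<exists>L \<in> Spec (image_plus A B f J). \<exists>L' \<in> Spec (image_plus A C g J'). J \<subseteq> L \<and> J' \<subseteq> L' \<and>
        P = bar_fst A B C f g J J' L \<and> P = bar_snd A B C f g J J' L'" if "J \<times> J' \<subseteq> P"
      by (rule ex_bar_fst_bar_snd[OF P that])
    show "\<not> J \<times> J' \<subseteq> P \<longleftrightarrow>
        (\<exists>!L. L \<in> Spec (image_plus A B f J) \<and> \<not> J \<subseteq> L \<and> P = bar_fst A B C f g J J' L) \<or>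
        (\<exists>!L. L \<in> Spec (image_plus A C g J') \<and> \<not> J' \<subseteq> L \<and> P = bar_snd A B C f g J J' L)"
      \<comment> \<open>Every prime contains one of the kernels, which selects a disjunct;
        conversely, either disjunct already includes that \<open>J \<times> J'\<close> is not
        contained in \<open>P\<close>.\<close>
      unfolding ex1_bar_fst_iff[OF P] ex1_bar_snd_iff[OF P] using Spec_cases[OF P] by blast
    show "\<not> ((\<exists>!L. L \<in> Spec (image_plus A B f J) \<and> \<not> J \<subseteq> L \<and> P = bar_fst A B C f g J J' L) \<and>
        (\<exists>!L. L \<in> Spec (image_plus A C g J') \<and> \<not> J' \<subseteq> L \<and> P = bar_snd A B C f g J J' L))"
      \<comment> \<open>The alternatives exclude each other: both kernels together would force
        \<open>J \<times> J'\<close> into \<open>P\<close>.\<close>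
      unfolding ex1_bar_fst_iff[OF P] ex1_bar_snd_iff[OF P] using kernels by blast
  qed (use localization_bar_fst localization_bar_snd in blast)+
qed

end
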